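(* Let $G$ be a compact subgroup of $\mathrm{U}(N)$ for some $N\ge 1$. If the corresponding action of $G$ on $\mathbb{C}^N$ is coisotropic with respect to the standard symplectic form on $\mathbb{C}^N$, then the real $G$-module $\mathbb{C}^N\simeq\mathbb{R}^{2N}$ does not contain two distinct equivalent $G$-submodules.
   Context: A submanifold $W$ of a symplectic manifold $(M,\omega)$ is coisotropic if $(T_pW)^{\perp_\omega}\subseteq T_pW$ for all $p\in W$, where $\perp_\omega$ denotes the $\omega$-orthogonal complement in $T_pM$. The action of $G$ is coisotropic if its principal orbits are coisotropic submanifolds. Submodules are real $G$-invariant linear subspaces, and two submodules are equivalent if there is a $G$-equivariant real linear isomorphism between them. *)

theory Defs
  imports "HOL-Analysis.Analysis" "HOL-Algebra.Group_Action"
begin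

definition adjoint_matrix :: "complex^'n^'m \<Rightarrow> complex^'m^'n" where
  "adjoint_matrix A = (\<chi> i j. cnj (A $ j $ i))"

text \<open>The dimension $N \ge 1$ of $\mathrm{U}(N)$ is the cardinality of the index type.\<close>

definition unitary_group :: "(complex^'n::finite^'n) monoid" where
  "unitary_group =
    \<lparr>carrier = {A. adjoint_matrix A ** A = mat 1}, monoid.mult = (**), one = mat 1\<rparr>"

lemma group_unitary_group: "group (unitary_group :: (complex^'n::finite^'n) monoid)"
proof (rule groupI)
  have adj_mult: "adjoint_matrix (A ** B) = adjoint_matrix B ** adjoint_matrix A"
    for A B :: "complex^'n^'n"
    by (simp add: adjoint_matrix_def matrix_matrix_mult_def vec_eq_iff mult.commute)
  have adj_adj: "adjoint_matrix (adjoint_matrix A) = A" for A :: "complex^'n^'n"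
    by (simp add: adjoint_matrix_def vec_eq_iff)
  fix x y z :: "complex^'n^'n"
  show "\<one>\<^bsub>unitary_group\<^esub> \<in> carrier (unitary_group :: (complex^'n^'n) monoid)"
    by (auto simp: unitary_group_def adjoint_matrix_def mat_def vec_eq_iff
        matrix_matrix_mult_def if_distrib [of cnj] if_distrib [of "\<lambda>x. x * _"]
        cong: if_cong)
  show "x \<otimes>\<^bsub>unitary_group\<^esub> y \<otimes>\<^bsub>unitary_group\<^esub> z = x \<otimes>\<^bsub>unitary_group\<^esub> (y \<otimes>\<^bsub>unitary_group\<^esub> z)"
    by (simp add: unitary_group_def matrix_mul_assoc)
  show "\<one>\<^bsub>unitary_group\<^esub> \<otimes>\<^bsub>unitary_group\<^esub> x = x"
    by (simp add: unitary_group_def)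
  assume x: "x \<in> carrier unitary_group"
  then have 1: "adjoint_matrix x ** x = mat 1"
    by (simp add: unitary_group_def)
  then have 2: "x ** adjoint_matrix x = mat 1"
    by (simp add: matrix_left_right_inverse)
  show "\<exists>w\<in>carrier unitary_group. w \<otimes>\<^bsub>unitary_group\<^esub> x = \<one>\<^bsub>unitary_group\<^esub>"
    by (rule bexI [of _ "adjoint_matrix x"]) (simp_all add: unitary_group_def adj_adj 1 2)
  assume "y \<in> carrier unitary_group"
  then have y: "adjoint_matrix y ** y = mat 1"
    by (simp add: unitary_group_def)
  have "adjoint_matrix (x ** y) ** (x ** y) = adjoint_matrix y ** (adjoint_matrix x ** x) ** y"
    by (simp only: adj_mult matrix_mul_assoc)
  then show "x \<otimes>\<^bsub>unitary_group\<^esub> y \<in> carrier unitary_group"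
    by (simp add: unitary_group_def 1 y)
qed

text \<open>The standard form $\sum_j dx_j \wedge dy_j$ in the coordinates $z_j = x_j + i y_j$.\<close>

definition symplectic_form :: "complex^'n::finite \<Rightarrow> complex^'n \<Rightarrow> real" where
  "symplectic_form u v = (\<Sum>j\<in>UNIV. Re (u $ j) * Im (v $ j) - Im (u $ j) * Re (v $ j))"

definition symplectic_complement :: "(complex^'n::finite) set \<Rightarrow> (complex^'n) set" where
  "symplectic_complement S = {u. \<forall>v\<in>S. symplectic_form u v = 0}"

text \<open>Velocities at \<open>p\<close> of the $C^1$ curves running in \<open>W\<close>. This is the tangent space
  $T_pW$ when \<open>W\<close> is an embedded submanifold, in particular when \<open>W\<close> is an orbit of a
  compact group of linear maps.\<close>

definition tangent_space :: "'a::real_normed_vector set \<Rightarrow> 'a \<Rightarrow> 'a set" where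
  "tangent_space W p =
    {v. \<exists>(\<gamma> :: real \<Rightarrow> 'a) \<epsilon>. \<epsilon> > 0 \<and> \<gamma> C1_differentiable_on {-\<epsilon><..<\<epsilon>} \<and>
          \<gamma> ` {-\<epsilon><..<\<epsilon>} \<subseteq> W \<and> \<gamma> 0 = p \<and> (\<gamma> has_vector_derivative v) (at 0)}"

text \<open>To be used for submanifolds \<open>W\<close> only. Orbits of compact groups, to which it is applied
  below, are always embedded submanifolds, so this is not required separately.\<close>

definition coisotropic :: "(complex^'n::finite) set \<Rightarrow> bool" where
  "coisotropic W \<longleftrightarrow>
    (\<forall>p\<in>W. symplectic_complement (tangent_space W p) \<subseteq> tangent_space W p)"

abbreviation unitary_subgroup :: "(complex^'n::finite^'n) set \<Rightarrow> (complex^'n^'n) monoid" where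
  "unitary_subgroup G \<equiv> unitary_group\<lparr>carrier := G\<rparr>"

text \<open>A principal orbit is one of maximal orbit type: its isotropy groups are conjugate in
  \<open>G\<close> to subgroups of every isotropy group.\<close>

definition principal_orbit :: "(complex^'n::finite^'n) set \<Rightarrow> (complex^'n) set \<Rightarrow> bool" where
  "principal_orbit G W \<longleftrightarrow>
    (\<exists>p. W = orbit (unitary_subgroup G) (*v) p \<and>
      (\<forall>q. \<exists>g\<in>G. (\<lambda>h. g ** h ** inv\<^bsub>unitary_group\<^esub> g) ` stabilizer (unitary_subgroup G) (*v) p
                    \<subseteq> stabilizer (unitary_subgroup G) (*v) q))"

definition coisotropic_action :: "(complex^'n::finite^'n) set \<Rightarrow> bool" where
  "coisotropic_action G \<longleftrightarrow> (\<forall>W. principal_orbit G W \<longrightarrow> coisotropic W)"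

text \<open>\<open>subspace\<close> refers to the real vector space structure of $\mathbb{C}^N$.\<close>

definition real_submodule :: "(complex^'n::finite^'n) set \<Rightarrow> (complex^'n) set \<Rightarrow> bool" where
  "real_submodule G V \<longleftrightarrow> subspace V \<and> (\<forall>g\<in>G. \<forall>v\<in>V. g *v v \<in> V)"

definition equivalent_submodules ::
    "(complex^'n::finite^'n) set \<Rightarrow> (complex^'n) set \<Rightarrow> (complex^'n) set \<Rightarrow> bool" where
  "equivalent_submodules G V V' \<longleftrightarrow>
    (\<exists>f. bij_betw f V V' \<and>
         (\<forall>u\<in>V. \<forall>v\<in>V. f (u + v) = f u + f v) \<and>
         (\<forall>c::real. \<forall>v\<in>V. f (c *\<^sub>R v) = c *\<^sub>R f v) \<and>
         (\<forall>g\<in>G. \<forall>v\<in>V. f (g *v v) = g *v f v))"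

end

theory Submission
  imports Defs
begin

text \<open>
  Multiplicity-freeness is detected by quadratic invariants. Let \<open>J\<close> be multiplication by
  \<open>\<i>\<close>. If \<open>A\<close> is a self-adjoint real operator commuting with \<open>G\<close>, then
  \<open>\<langle>A x, x\<rangle>\<close> is a \<open>G\<close>-invariant function, so its gradient is normal to every orbit. Where the orbit
  is coisotropic, \<open>J\<close> maps normal vectors to tangent vectors; hence \<open>\<langle>B p, J (A p)\<rangle> = 0\<close> for any
  two such operators at a principal point \<open>p\<close>: the invariants Poisson-commute
  (\<open>equivariant_self_adjoint_poisson_commute\<close>). Principal points are dense, so this quadratic form in \<open>p\<close>
  vanishes identically, and polarization gives \<open>B J A = A J B\<close>. With \<open>B = 1\<close> it follows that
  \<open>A\<close> commutes with \<open>J\<close>, and then that \<open>A\<close> and \<open>B\<close> commute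
  (\<open>equivariant_self_adjoint_commute\<close>).

  Since all self-adjoint equivariant operators commute with each other and with \<open>J\<close>, every
  equivariant operator \<open>F\<close> is normal (\<open>equivariant_is_normal\<close>), and so
  \<open>(ker F)\<^sup>\<bottom> = range F\<close>. Extending an equivalence \<open>V \<rightarrow> V'\<close> by zero on \<open>V\<^sup>\<bottom>\<close> gives
  an equivariant operator with \<open>(ker F)\<^sup>\<bottom> = V\<close> and \<open>range F = V'\<close>; hence \<open>V = V'\<close>.

  Existence and density of principal points rest on a convexity argument: on a shortest segment
  between two orbits, the isotropy group of an interior point fixes both end points
  (\<open>isotropy_minimal_segment\<close>).
\<close>

section \<open>Unitary matrices and the complex structure\<close>

abbreviation J :: "complex^'n::finite \<Rightarrow> complex^'n" where
  "J x \<equiv> \<i> *s x"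

lemma linear_J: "linear (J :: complex^'n::finite \<Rightarrow> complex^'n)"
  by (rule linearI) (simp_all add: vec_eq_iff algebra_simps)

lemma J_J: "J (J x) = - x"
  by (simp add: vec_eq_iff flip: mult.assoc)

lemma inner_J_left: "inner (J x) y = - inner x (J y)"
  by (simp add: inner_vec_def inner_complex_def sum_negf [symmetric])

lemma symplectic_form_eq_inner: "symplectic_form u v = inner (J u) v"
  by (simp add: symplectic_form_def inner_vec_def inner_complex_def)

lemma linear_matrix_vector_mult_complex:
  "linear ((*v) (A :: complex^'n::finite^'m::finite))"
  by (rule linearI)
    (simp_all add: matrix_vector_mult_def vec_eq_iff scaleR_sum_right distrib_left sum.distrib)

lemma matrix_vector_mult_J: "A *v J x = J (A *v x)"
  by (simp add: matrix_vector_mult_def vec_eq_iff sum_distrib_left algebra_simps)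

lemma inner_adjoint_matrix:
  fixes A :: "complex^'n::finite^'m::finite"
  shows "inner (A *v x) y = inner x (adjoint_matrix A *v y)"
proof -
  have inner_mult: "inner (a * u) v = inner u (cnj a * v)" for a u v :: complex
    by (simp add: inner_complex_def algebra_simps)
  have "inner (A *v x) y = (\<Sum>i\<in>UNIV. \<Sum>j\<in>UNIV. inner (x $ j) (cnj (A $ i $ j) * y $ i))"
    by (simp add: inner_vec_def matrix_vector_mult_def inner_sum_left inner_mult)
  also have "\<dots> = (\<Sum>j\<in>UNIV. \<Sum>i\<in>UNIV. inner (x $ j) (cnj (A $ i $ j) * y $ i))"
    by (rule sum.swap)
  also have "\<dots> = inner x (adjoint_matrix A *v y)"
    by (simp add: inner_vec_def matrix_vector_mult_def adjoint_matrix_def inner_sum_right)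
  finally show ?thesis .
qed

section \<open>Principal orbits\<close>

locale unitary_matrix_group =
  fixes G :: "(complex^'n::finite^'n) set"
  assumes subgroup_G: "subgroup G unitary_group"
begin

abbreviation isotropy :: "complex^'n \<Rightarrow> (complex^'n^'n) set" where
  "isotropy \<equiv> stabilizer (unitary_subgroup G) (*v)"

text \<open>Conjugating by \<open>k\<inverse>\<close> turns \<open>isotropy (k *v q)\<close> into \<open>isotropy q\<close>. So these are the points
  whose isotropy group is, up to conjugacy, contained in every isotropy group, written without
  inverses.\<close>

abbreviation principal :: "complex^'n \<Rightarrow> bool" where
  "principal p \<equiv> (\<forall>q. \<exists>k\<in>G. isotropy p \<subseteq> isotropy (k *v q))"

lemma isotropy_iff: "g \<in> isotropy p \<longleftrightarrow> g \<in> G \<and> g *v p = p"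
  by (simp add: stabilizer_def)

lemma one_in: "mat 1 \<in> G"
  using subgroup.one_closed [OF subgroup_G] by (simp add: unitary_group_def)

lemma mult_in: "g \<in> G \<Longrightarrow> h \<in> G \<Longrightarrow> g ** h \<in> G"
  using subgroup.m_closed [OF subgroup_G] by (simp add: unitary_group_def)

lemma inv_in: "g \<in> G \<Longrightarrow> inv\<^bsub>unitary_group\<^esub> g \<in> G"
  using subgroup.m_inv_closed [OF subgroup_G] by blast

lemma inv_vec:
  assumes "g \<in> G"
  shows "inv\<^bsub>unitary_group\<^esub> g *v (g *v x) = x" "g *v (inv\<^bsub>unitary_group\<^esub> g *v x) = x"
proof -
  have g: "g \<in> carrier unitary_group"
    using subgroup.subset [OF subgroup_G] assms by blast
  show "inv\<^bsub>unitary_group\<^esub> g *v (g *v x) = x" "g *v (inv\<^bsub>unitary_group\<^esub> g *v x) = x"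
    using group.l_inv [OF group_unitary_group g] group.r_inv [OF group_unitary_group g]
    by (simp_all add: unitary_group_def matrix_vector_mul_assoc)
qed

lemma inner_vec:
  assumes "g \<in> G"
  shows "inner (g *v x) (g *v y) = inner x y"
proof -
  have "adjoint_matrix g ** g = mat 1"
    using subgroup.subset [OF subgroup_G] assms by (auto simp: unitary_group_def)
  then show ?thesis
    by (simp add: inner_adjoint_matrix matrix_vector_mul_assoc)
qed

text \<open>If \<open>h\<close> fixes an interior point \<open>x\<close>, then the path from \<open>q\<close> straight to \<open>x\<close> and on to
  \<open>h *v p\<close> has length \<open>norm (q - p)\<close>. By minimality it cannot be shortened, so it does not bend at
  \<open>x\<close>, and \<open>h *v p = p\<close>.\<close>

lemma isotropy_minimal_segment:
  assumes minimal: "\<And>k. k \<in> G \<Longrightarrow> norm (q - p) \<le> norm (q - k *v p)"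
    and t: "0 < t" "t < 1"
  shows "isotropy (q + t *\<^sub>R (p - q)) \<subseteq> isotropy p \<inter> isotropy q"
proof
  fix h
  define d where "d = q - p"
  define x where "x = q + t *\<^sub>R (p - q)"
  assume "h \<in> isotropy (q + t *\<^sub>R (p - q))"
  then have h: "h \<in> G" and hx: "h *v x = x"
    by (auto simp: isotropy_iff x_def)
  interpret h: linear "(*v) h"
    by (rule linear_matrix_vector_mult_complex)
  have q: "q = x + t *\<^sub>R d" and p: "p = x - (1 - t) *\<^sub>R d"
    by (simp_all add: x_def d_def algebra_simps)
  have hq: "h *v q = x + t *\<^sub>R (h *v d)" and hp: "h *v p = x - (1 - t) *\<^sub>R (h *v d)"
    by (simp_all add: q p h.add h.diff h.scaleR hx del: scaleR_left_diff_distrib)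
  \<comment> \<open>The left-hand side is the distance from \<open>q\<close> to \<open>p\<close>, the right-hand side that to \<open>h *v p\<close>.
      Since \<open>d\<close> and \<open>h *v d\<close> have equal length, strict convexity forces them to agree.\<close>
  have "norm d \<le> norm (t *\<^sub>R d + (1 - t) *\<^sub>R (h *v d))"
    using minimal [OF h] unfolding hp by (simp add: p q flip: scaleR_add_left)
  then have "inner d d
      \<le> inner (t *\<^sub>R d + (1 - t) *\<^sub>R (h *v d)) (t *\<^sub>R d + (1 - t) *\<^sub>R (h *v d))"
    by (simp add: norm_le)
  also have "\<dots> = inner d d - 2 * (t * (1 - t)) * (inner d d - inner d (h *v d))"
    using inner_vec [OF h, of d d]
    by (simp add: inner_add_left inner_add_right inner_diff_left inner_diff_right inner_commute
        algebra_simps)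
  finally have "(t * (1 - t)) * (inner d d - inner d (h *v d)) \<le> 0"
    by simp
  then have "inner d d \<le> inner d (h *v d)"
    using t by (simp add: mult_le_0_iff)
  then have "inner (h *v d - d) (h *v d - d) \<le> 0"
    using inner_vec [OF h, of d d] by (simp add: inner_diff_left inner_diff_right inner_commute)
  then have "h *v d = d"
    by (metis inner_gt_zero_iff not_less right_minus_eq)
  then show "h \<in> isotropy p \<inter> isotropy q"
    using h hp hq p q by (simp add: isotropy_iff)
qed

lemma ex_minimal_segment:
  assumes "compact G"
  obtains g where "g \<in> G" "\<And>k. k \<in> G \<Longrightarrow> norm (q - g *v p) \<le> norm (q - k *v (g *v p))"
proof -
  have "continuous_on G (\<lambda>g. norm (q - g *v p))"
    unfolding matrix_vector_mult_def by (intro continuous_intros)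
  then obtain g where "g \<in> G" "\<And>k. k \<in> G \<Longrightarrow> norm (q - g *v p) \<le> norm (q - k *v p)"
    using continuous_attains_inf [OF assms] one_in by (metis empty_iff)
  then show thesis
    by (metis that matrix_vector_mul_assoc mult_in)
qed

text \<open>An isotropy group and its fixed space determine each other, because \<open>p\<close> itself lies in the
  fixed space of \<open>isotropy p\<close>. Hence dimensions of fixed spaces bound the length of chains of
  isotropy groups, and a point with a fixed space of largest dimension has a minimal isotropy group.
  A shortest segment to any other orbit contains a point whose isotropy group lies below those of
  both end points, so this minimal group is contained in a conjugate of any other.\<close>

lemma ex_principal:
  assumes "compact G"
  obtains p where "principal p"
proof -
  define Fix where "Fix p = {v. \<forall>h\<in>isotropy p. h *v v = v}" for p
  have subspace: "subspace (Fix p)" for p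
    using linear_matrix_vector_mult_complex
    by (auto simp: Fix_def subspace_def linear_0 linear_add linear_scale)
  have isotropy_anti: "isotropy p \<subseteq> isotropy x" if "Fix x \<subseteq> Fix p" for p x
  proof -
    have "x \<in> Fix x"
      by (simp add: Fix_def isotropy_iff)
    with that show ?thesis
      by (auto simp: Fix_def isotropy_iff)
  qed
  have "dim (Fix x) < Suc DIM(complex^'n)" for x
    using dim_subset_UNIV [of "Fix x"] by simp
  then obtain p where p: "\<And>x. dim (Fix x) \<le> dim (Fix p)"
    using ex_has_greatest_nat [of "\<lambda>_. True" 0 "\<lambda>p. dim (Fix p)" "Suc DIM(complex^'n)"] by blast
  have "\<exists>k\<in>G. isotropy p \<subseteq> isotropy (k *v q)" for q
  proof -
    obtain g where g: "g \<in> G"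
        "\<And>k. k \<in> G \<Longrightarrow> norm (p - g *v q) \<le> norm (p - k *v (g *v q))"
      using ex_minimal_segment [OF assms] by blast
    define x where "x = p + (1/2) *\<^sub>R (g *v q - p)"
    have x: "isotropy x \<subseteq> isotropy (g *v q) \<inter> isotropy p"
      unfolding x_def by (rule isotropy_minimal_segment) (use g in auto)
    then have "Fix p \<subseteq> Fix x"
      by (auto simp: Fix_def)
    then have "Fix x = Fix p"
      using subspace_dim_equal [OF subspace subspace] p by metis
    then have "isotropy p \<subseteq> isotropy x"
      by (intro isotropy_anti) simp
    with x g(1) show ?thesis
      by blast
  qed
  then show thesis
    by (intro that) blast
qed

lemma principal_mult:
  assumes "principal p" and g: "g \<in> G" and x: "isotropy x \<subseteq> isotropy (g *v p)"
  shows "principal x"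
proof
  fix q
  obtain k where k: "k \<in> G" "isotropy p \<subseteq> isotropy (k *v q)"
    using assms(1) by blast
  let ?g' = "inv\<^bsub>unitary_group\<^esub> g"
  have "h \<in> isotropy ((g ** k) *v q)" if "h \<in> isotropy x" for h
  proof -
    have h: "h \<in> G" "h *v (g *v p) = g *v p"
      using that x by (auto simp: isotropy_iff)
    then have "(?g' ** h ** g) *v p = p"
      by (simp flip: matrix_vector_mul_assoc add: inv_vec g)
    then have "?g' ** h ** g \<in> isotropy p"
      by (simp add: isotropy_iff mult_in inv_in g h)
    then have "?g' ** h ** g \<in> isotropy (k *v q)"
      using k(2) by blast
    then have "?g' *v (h *v (g *v (k *v q))) = k *v q"
      by (simp add: isotropy_iff flip: matrix_vector_mul_assoc)
    then have "h *v (g *v (k *v q)) = g *v (k *v q)"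
      using inv_vec(2) [OF g] by metis
    then show ?thesis
      by (simp add: isotropy_iff h flip: matrix_vector_mul_assoc)
  qed
  then show "\<exists>k\<in>G. isotropy x \<subseteq> isotropy (k *v q)"
    using mult_in [OF g k(1)] by blast
qed

text \<open>All interior points of a shortest segment from \<open>q\<close> to a principal orbit are principal, and
  they accumulate at \<open>q\<close>.\<close>

lemma principal_dense:
  assumes "compact G"
  shows "\<exists>x. (\<forall>n. principal (x n)) \<and> x \<longlonglongrightarrow> q"
proof -
  obtain p where p: "principal p"
    using ex_principal [OF assms] by blast
  obtain g where g: "g \<in> G"
      "\<And>k. k \<in> G \<Longrightarrow> norm (q - g *v p) \<le> norm (q - k *v (g *v p))"
    using ex_minimal_segment [OF assms] by blast
  \<comment> \<open>The offset 2 keeps the parameter strictly between 0 and 1.\<close>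
  define x where "x n = q + (1 / real (n + 2)) *\<^sub>R (g *v p - q)" for n
  have "isotropy (x n) \<subseteq> isotropy (g *v p)" for n
    using isotropy_minimal_segment [OF g(2), of "1 / real (n + 2)"] by (simp add: x_def)
  then have "principal (x n)" for n
    by (rule principal_mult [OF p g(1)])
  moreover have "x \<longlonglongrightarrow> q + 0 *\<^sub>R (g *v p - q)"
    unfolding x_def
    by (intro tendsto_intros LIMSEQ_ignore_initial_segment [OF lim_1_over_n])
  ultimately show ?thesis
    by auto
qed

lemma principal_orbit_orbit:
  assumes "principal p"
  shows "principal_orbit G (orbit (unitary_subgroup G) (*v) p)"
proof -
  have "\<exists>g\<in>G. (\<lambda>h. g ** h ** inv\<^bsub>unitary_group\<^esub> g) ` isotropy p \<subseteq> isotropy q" for q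
  proof -
    obtain k where k: "k \<in> G" "isotropy p \<subseteq> isotropy (k *v q)"
      using assms by blast
    let ?g = "inv\<^bsub>unitary_group\<^esub> k"
    have "inv\<^bsub>unitary_group\<^esub> ?g = k"
      using group.inv_inv [OF group_unitary_group] subgroup.subset [OF subgroup_G] k(1) by blast
    moreover have "?g ** h ** k \<in> isotropy q" if "h \<in> isotropy p" for h
      using that k
      by (auto simp: isotropy_iff mult_in inv_in inv_vec subset_iff
          simp flip: matrix_vector_mul_assoc)
    ultimately show ?thesis
      by (intro bexI [of _ ?g]) (auto simp: inv_in k(1))
  qed
  then show ?thesis
    unfolding principal_orbit_def by blast
qed

section \<open>Equivariant self-adjoint operators\<close>

definition equivariant :: "(complex^'n \<Rightarrow> complex^'n) \<Rightarrow> bool" where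
  "equivariant A \<longleftrightarrow> linear A \<and> (\<forall>g\<in>G. \<forall>x. A (g *v x) = g *v A x)"

definition equivariant_self_adjoint :: "(complex^'n \<Rightarrow> complex^'n) \<Rightarrow> bool" where
  "equivariant_self_adjoint A \<longleftrightarrow> equivariant A \<and> (\<forall>x y. inner (A x) y = inner x (A y))"

text \<open>The vector \<open>2 *\<^sub>R A p\<close> is the gradient at \<open>p\<close> of the function \<open>inner (A x) x\<close>, which is
  constant on orbits.\<close>

lemma equivariant_self_adjoint_normal_to_orbit:
  assumes A: "equivariant_self_adjoint A" and v: "v \<in> tangent_space (orbit (unitary_subgroup G) (*v) p) p"
  shows "inner (A p) v = 0"
proof -
  have linA: "linear A" and eqA: "\<And>g x. g \<in> G \<Longrightarrow> A (g *v x) = g *v A x"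
      and symA: "\<And>x y. inner (A x) y = inner x (A y)"
    using A by (auto simp: equivariant_self_adjoint_def equivariant_def)
  obtain \<gamma> :: "real \<Rightarrow> complex^'n" and \<epsilon> where \<epsilon>: "\<epsilon> > 0"
      and \<gamma>: "\<gamma> ` {-\<epsilon><..<\<epsilon>} \<subseteq> orbit (unitary_subgroup G) (*v) p" "\<gamma> 0 = p"
        "(\<gamma> has_vector_derivative v) (at 0)"
    using v by (auto simp: tangent_space_def)
  have "bounded_linear A"
    using linA by (rule linear_conv_bounded_linear [THEN iffD1])
  then have "((\<lambda>t. A (\<gamma> t)) has_vector_derivative A v) (at 0)"
    using \<gamma>(3) by (rule bounded_linear.has_vector_derivative)
  from bounded_bilinear.has_vector_derivative [OF bounded_bilinear_inner this \<gamma>(3)]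
  have "((\<lambda>t. inner (A (\<gamma> t)) (\<gamma> t)) has_vector_derivative
      (inner (A p) v + inner (A v) p)) (at 0)"
    by (simp add: \<gamma>(2))
  moreover have const: "inner (A (\<gamma> t)) (\<gamma> t) = inner (A p) p" if "t \<in> {-\<epsilon><..<\<epsilon>}" for t
  proof -
    have "\<gamma> t \<in> orbit (unitary_subgroup G) (*v) p"
      using \<gamma>(1) that by blast
    then obtain g where "g \<in> G" "\<gamma> t = g *v p"
      by (auto simp: orbit_def)
    then show ?thesis
      by (simp add: eqA inner_vec)
  qed
  have "((\<lambda>t. inner (A (\<gamma> t)) (\<gamma> t)) has_vector_derivative 0) (at 0)"
    by (rule has_vector_derivative_transform_within_open
        [where f = "\<lambda>_. inner (A p) p" and S = "{-\<epsilon><..<\<epsilon>}"])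
      (use \<epsilon> const in \<open>auto intro: derivative_eq_intros\<close>)
  ultimately have "inner (A p) v + inner (A v) p = 0"
    by (rule vector_derivative_unique_at)
  then show ?thesis
    using symA [of v p] by (simp add: inner_commute)
qed

text \<open>The left-hand side is, up to a constant factor, the Poisson bracket of the invariant functions
  \<open>inner (A x) x\<close> and \<open>inner (B x) x\<close> at \<open>q\<close>. At a principal point both gradients are normal to the
  orbit, so the vector \<open>J (A p)\<close> is symplectically orthogonal to the tangent space, hence tangent
  by coisotropy, hence orthogonal to \<open>B p\<close>. Density of the principal points does the rest.\<close>

lemma equivariant_self_adjoint_poisson_commute:
  assumes "compact G" "coisotropic_action G"
    and A: "equivariant_self_adjoint A" and B: "equivariant_self_adjoint B"
  shows "inner (B q) (J (A q)) = 0"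
proof -
  have principal: "inner (B p) (J (A p)) = 0" if "principal p" for p
  proof -
    let ?W = "orbit (unitary_subgroup G) (*v) p"
    have "p \<in> ?W"
      using one_in by (auto simp: orbit_def intro: exI [of _ "mat 1"])
    moreover have "coisotropic ?W"
      using assms(2) principal_orbit_orbit [OF that] by (simp add: coisotropic_action_def)
    ultimately have "symplectic_complement (tangent_space ?W p) \<subseteq> tangent_space ?W p"
      by (simp add: coisotropic_def)
    moreover have "J (A p) \<in> symplectic_complement (tangent_space ?W p)"
      using equivariant_self_adjoint_normal_to_orbit [OF A]
      by (simp add: symplectic_complement_def symplectic_form_eq_inner J_J
          del: vector_smult_assoc)
    ultimately show ?thesis
      using equivariant_self_adjoint_normal_to_orbit [OF B] by blast
  qed
  obtain x where x: "\<And>n. principal (x n)" "x \<longlonglongrightarrow> q"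
    using principal_dense [OF assms(1)] by blast
  have lin: "linear A" "linear B"
    using A B by (auto simp: equivariant_self_adjoint_def equivariant_def)
  then have lim: "(\<lambda>n. T (x n)) \<longlonglongrightarrow> T q" if "linear T" for T :: "complex^'n \<Rightarrow> complex^'n"
    using bounded_linear.tendsto that x(2) by (blast dest: linear_conv_bounded_linear [THEN iffD1])
  have "(\<lambda>n. inner (B (x n)) (J (A (x n)))) \<longlonglongrightarrow> inner (B q) (J (A q))"
    using lim [OF lin(2)] lim [OF linear_compose [OF lin(1) linear_J]]
    by (intro tendsto_inner) (simp_all add: o_def)
  then show ?thesis
    using principal [OF x(1)] by (simp add: LIMSEQ_const_iff)
qed

text \<open>Polarizing the vanishing Poisson bracket gives \<open>B J A = A J B\<close>. The identity is an admissible
  \<open>B\<close>, which shows that \<open>A\<close> commutes with \<open>J\<close>; then \<open>J\<close> can be cancelled.\<close>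

lemma equivariant_self_adjoint_commute:
  assumes "compact G" "coisotropic_action G"
    and A: "equivariant_self_adjoint A" and B: "equivariant_self_adjoint B"
  shows "A (J x) = J (A x)" "A (B x) = B (A x)"
proof -
  have twisted: "B (J (A x)) = A (J (B x))"
    if A: "equivariant_self_adjoint A" and B: "equivariant_self_adjoint B" for A B x
  proof -
    have lin: "linear A" "linear B"
        and sym: "\<And>x y. inner (A x) y = inner x (A y)" "\<And>x y. inner (B x) y = inner x (B y)"
      using A B by (auto simp: equivariant_self_adjoint_def equivariant_def)
    have zero: "inner (B x) (J (A x)) = 0" for x
      using equivariant_self_adjoint_poisson_commute [OF assms(1,2) A B] .
    have "inner y (B (J (A x))) = inner y (A (J (B x)))" for y
    proof -
      have "inner (B y) (J (A x)) + inner (B x) (J (A y)) = 0"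
        using zero [of "x + y"] zero [of x] zero [of y]
        by (simp add: linear_add [OF lin(1)] linear_add [OF lin(2)] linear_add [OF linear_J]
            inner_add_left inner_add_right)
      then have "inner (B y) (J (A x)) = inner (J (B x)) (A y)"
        by (simp add: inner_J_left)
      then show ?thesis
        using sym(2) [of y "J (A x)"] sym(1) [of y "J (B x)"] by (simp add: inner_commute)
    qed
    then show ?thesis
      by (rule vector_eq_ldot [THEN iffD1, OF allI])
  qed
  have id: "equivariant_self_adjoint (\<lambda>x. x)"
    by (simp add: equivariant_self_adjoint_def equivariant_def linear_ident)
  show AJ: "A (J x) = J (A x)" for x
    using twisted [OF A id, of x] by simp
  have BJ: "B (J x) = J (B x)" for x
    using twisted [OF B id, of x] by simp
  have "J (A (B x)) = J (B (A x))"
    using twisted [OF A B, of x] by (simp add: AJ BJ)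
  then show "A (B x) = B (A x)"
    by (simp add: vec_eq_iff)
qed

lemma equivariant_adjoint:
  assumes "equivariant F"
  shows "equivariant (adjoint F)"
proof -
  have lin: "linear F" and eq: "\<And>g x. g \<in> G \<Longrightarrow> F (g *v x) = g *v F x"
    using assms by (auto simp: equivariant_def)
  have "adjoint F (g *v x) = g *v adjoint F x" if g: "g \<in> G" for g x
  proof -
    have "inner z (adjoint F (g *v x)) = inner z (g *v adjoint F x)" for z
    proof -
      define y where "y = inv\<^bsub>unitary_group\<^esub> g *v z"
      have z: "z = g *v y"
        by (simp add: y_def inv_vec g)
      show ?thesis
        unfolding z by (simp add: adjoint_works [OF lin] eq [OF g] inner_vec [OF g])
    qed
    then show ?thesis
      by (rule vector_eq_ldot [THEN iffD1, OF allI])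
  qed
  then show ?thesis
    by (simp add: equivariant_def adjoint_linear lin)
qed

text \<open>Write \<open>S\<close> and \<open>K\<close> for twice the self-adjoint and the skew part of \<open>F\<close>. Normality of \<open>F\<close> means
  that the self-adjoint operator \<open>C = (S K - K S) / 2\<close> vanishes. The skew operator \<open>K\<close> becomes
  self-adjoint by forming \<open>M = J K + K J\<close>. Now \<open>S\<close> commutes with \<open>M\<close>, and \<open>S\<close> and \<open>C\<close> commute with
  \<open>J\<close>, so \<open>0 = S M - M S = 4 J C\<close>.\<close>

lemma equivariant_is_normal:
  assumes "compact G" "coisotropic_action G" and F: "equivariant F"
  shows "adjoint F (F x) = F (adjoint F x)"
proof -
  define F' where "F' = adjoint F"
  have F': "equivariant F'"
    unfolding F'_def using F by (rule equivariant_adjoint)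
  have lin: "linear F" "linear F'"
      and eq: "\<And>g x. g \<in> G \<Longrightarrow> F (g *v x) = g *v F x" "\<And>g x. g \<in> G \<Longrightarrow> F' (g *v x) = g *v F' x"
    using F F' by (auto simp: equivariant_def)
  note linJ = linear_J [where 'n = 'n]
  note add = linear_add [OF lin(1)] linear_add [OF lin(2)] linear_add [OF linJ]
  note diff = linear_diff [OF lin(1)] linear_diff [OF lin(2)] linear_diff [OF linJ]
  have adj: "inner (F x) y = inner x (F' y)" "inner (F' x) y = inner x (F y)" for x y
    using adjoint_works [OF lin(1)] by (simp_all add: F'_def inner_commute)
  have eqsub: "g *v (x - y) = g *v x - g *v y" "g *v (x + y) = g *v x + g *v y"
    for g :: "complex^'n^'n" and x y
    by (simp_all add: matrix_vector_mult_diff_distrib matrix_vector_right_distrib)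
  define S where "S x = F x + F' x" for x
  define K where "K x = F x - F' x" for x
  define M where "M x = J (K x) + K (J x)" for x
  define C where "C x = F' (F x) - F (F' x)" for x
  have "linear K"
    unfolding K_def by (intro linear_compose_sub lin)
  then have "linear S" "linear M" "linear C"
    unfolding S_def M_def C_def
    by (intro linear_compose_add linear_compose_sub lin
        linear_compose [OF _ linJ, unfolded o_def] linear_compose [OF linJ, unfolded o_def]
        linear_compose [OF lin, unfolded o_def] linear_compose [OF lin(2,1), unfolded o_def];
        assumption)+
  then have S: "equivariant_self_adjoint S" and M: "equivariant_self_adjoint M"
      and C: "equivariant_self_adjoint C"
    unfolding equivariant_self_adjoint_def equivariant_def
    by (simp_all add: S_def M_def K_def C_def eq eqsub flip: matrix_vector_mult_J)
      (simp_all add: inner_add_left inner_add_right inner_diff_left inner_diff_right adj inner_J_left)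
  note commute = equivariant_self_adjoint_commute [OF assms(1,2)]
  have SK: "S (K y) - K (S y) = 2 *\<^sub>R C y" for y
    by (simp add: S_def K_def C_def add diff scaleR_2)
  have "0 = S (M x) - M (S x)"
    using commute(2) [OF S M, of x] by simp
  also have "\<dots> = J (S (K x) - K (S x)) + (S (K (J x)) - K (S (J x)))"
    unfolding M_def linear_add [OF \<open>linear S\<close>] commute(1) [OF S S]
    by (simp add: diff)
  also have "\<dots> = 4 *\<^sub>R J (C x)"
    unfolding SK commute(1) [OF C C]
    by (simp add: linear_scale [OF linJ] flip: scaleR_add_left)
  finally have "J (C x) = 0"
    by simp
  then have "C x = 0"
    by (simp add: vec_eq_iff)
  then show ?thesis
    by (simp add: C_def F'_def)
qed

text \<open>The operator \<open>F\<close> is \<open>f\<close> after the orthogonal projection onto \<open>V\<close>. The projection commutes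
  with \<open>G\<close> because \<open>G\<close> preserves \<open>V\<close> and, being orthogonal, also the orthogonal complement of
  \<open>V\<close>.\<close>

lemma equivariant_extension:
  assumes V: "real_submodule G V" and V': "V' = f ` V" and inj: "inj_on f V"
    and f_add: "\<And>u v. u \<in> V \<Longrightarrow> v \<in> V \<Longrightarrow> f (u + v) = f u + f v"
    and f_scale: "\<And>c v. v \<in> V \<Longrightarrow> f (c *\<^sub>R v) = c *\<^sub>R f v"
    and f_eq: "\<And>g v. g \<in> G \<Longrightarrow> v \<in> V \<Longrightarrow> f (g *v v) = g *v f v"
  obtains F where "equivariant F" "range F = V'" "\<And>x. F x = 0 \<longleftrightarrow> (\<forall>v\<in>V. inner x v = 0)"
proof -
  have sub: "subspace V" and inv: "\<And>g v. g \<in> G \<Longrightarrow> v \<in> V \<Longrightarrow> g *v v \<in> V"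
    using V by (auto simp: real_submodule_def)
  have "\<exists>y. y \<in> V \<and> (\<forall>v\<in>V. inner (x - y) v = 0)" for x
  proof -
    obtain y z where "y \<in> span V" "\<And>w. w \<in> span V \<Longrightarrow> orthogonal z w" "x = y + z"
      using orthogonal_subspace_decomp_exists [of V x] by blast
    moreover have "span V = V"
      using sub by (simp add: span_eq_iff)
    ultimately show ?thesis
      by (intro exI [of _ y]) (auto simp: orthogonal_def)
  qed
  then obtain P where PV: "\<And>x. P x \<in> V" and P_orth: "\<And>x v. v \<in> V \<Longrightarrow> inner (x - P x) v = 0"
    by metis
  have P_unique: "P x = y" if "y \<in> V" "\<And>v. v \<in> V \<Longrightarrow> inner (x - y) v = 0" for x y
  proof -
    have "P x - y \<in> V"
      using sub PV that(1) by (rule subspace_diff)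
    then have "inner (x - y) (P x - y) - inner (x - P x) (P x - y) = 0"
      using that(2) P_orth by simp
    then have "inner (P x - y) (P x - y) = 0"
      by (simp flip: inner_diff_left)
    then show ?thesis
      by simp
  qed
  have P_add: "P (x + y) = P x + P y" for x y
  proof (rule P_unique)
    show "P x + P y \<in> V"
      using sub PV PV by (rule subspace_add)
    fix v assume "v \<in> V"
    then show "inner (x + y - (P x + P y)) v = 0"
      using P_orth [of v x] P_orth [of v y] by (simp add: inner_diff_left inner_add_left)
  qed
  have P_scale: "P (c *\<^sub>R x) = c *\<^sub>R P x" for c x
  proof (rule P_unique)
    show "c *\<^sub>R P x \<in> V"
      using sub PV by (rule subspace_scale)
    fix v assume "v \<in> V"
    then show "inner (c *\<^sub>R x - c *\<^sub>R P x) v = 0"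
      using P_orth [of v x] by (simp flip: scaleR_diff_right)
  qed
  have P_eq: "P (g *v x) = g *v P x" if g: "g \<in> G" for g x
  proof (rule P_unique)
    show "g *v P x \<in> V"
      using g PV by (rule inv)
    fix v assume v: "v \<in> V"
    have "inner (g *v x - g *v P x) v
        = inner (g *v (x - P x)) (g *v (inv\<^bsub>unitary_group\<^esub> g *v v))"
      by (simp add: matrix_vector_mult_diff_distrib inv_vec g)
    also have "\<dots> = 0"
      using P_orth [OF inv [OF inv_in [OF g] v]] by (simp add: inner_vec g)
    finally show "inner (g *v x - g *v P x) v = 0" .
  qed
  have f0: "f 0 = 0"
    using f_scale [of 0 0] subspace_0 [OF sub] by simp
  show thesis
  proof (rule that [of "f \<circ> P"])
    show "equivariant (f \<circ> P)"
      by (auto simp: equivariant_def P_add P_scale P_eq f_add f_scale f_eq PV intro!: linearI)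
    have "P v = v" if "v \<in> V" for v
      by (rule P_unique) (use that in auto)
    then have "range P = V"
      using PV by (auto simp: image_def) metis
    then show "range (f \<circ> P) = V'"
      by (metis V' image_comp)
    fix x
    have "(f \<circ> P) x = 0 \<longleftrightarrow> P x = 0"
      using inj_onD [OF inj, of "P x" 0] PV subspace_0 [OF sub] f0 by auto
    also have "\<dots> \<longleftrightarrow> (\<forall>v\<in>V. inner x v = 0)"
      using P_orth [of _ x] P_unique [of 0 x] subspace_0 [OF sub] by auto
    finally show "(f \<circ> P) x = 0 \<longleftrightarrow> (\<forall>v\<in>V. inner x v = 0)" .
  qed
qed

end

section \<open>Equivalent submodules coincide\<close>

theorem proposition1p6:
  fixes G :: "(complex^'n::finite^'n) set"
  assumes "subgroup G unitary_group"
    and "compact G"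
    and "coisotropic_action G"
  shows "\<not> (\<exists>V V'. real_submodule G V \<and> real_submodule G V' \<and> V \<noteq> V' \<and>
                   equivalent_submodules G V V')"
proof -
  interpret unitary_matrix_group G
    using assms(1) by (rule unitary_matrix_group.intro)
  have "V = V'" if V: "real_submodule G V" and V': "real_submodule G V'"
    and equiv: "equivalent_submodules G V V'" for V V'
  proof -
    obtain f where f: "bij_betw f V V'"
        "\<And>u v. u \<in> V \<Longrightarrow> v \<in> V \<Longrightarrow> f (u + v) = f u + f v"
        "\<And>c v. v \<in> V \<Longrightarrow> f (c *\<^sub>R v) = c *\<^sub>R f v"
        "\<And>g v. g \<in> G \<Longrightarrow> v \<in> V \<Longrightarrow> f (g *v v) = g *v f v"
      using equiv unfolding equivalent_submodules_def by blast
    obtain F where F: "equivariant F" "range F = V'"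
        "\<And>x. F x = 0 \<longleftrightarrow> (\<forall>v\<in>V. inner x v = 0)"
      using equivariant_extension [OF V bij_betw_imp_surj_on [OF f(1), symmetric]
          bij_betw_imp_inj_on [OF f(1)] f(2-4)] by blast
    have lin: "linear F"
      using F(1) by (simp add: equivariant_def)
    \<comment> \<open>These complements are the kernels of \<open>F\<close> and of its adjoint, which agree as \<open>F\<close> is
        normal.\<close>
    have "orthogonal_comp V = orthogonal_comp V'"
    proof (rule Set.set_eqI)
      fix x
      have "inner (F x) (F x) = inner x (adjoint F (F x))"
        by (simp add: adjoint_works [OF lin])
      also have "\<dots> = inner x (F (adjoint F x))"
        by (simp add: equivariant_is_normal [OF assms(2,3) F(1)])
      also have "\<dots> = inner (adjoint F x) (adjoint F x)"
        using adjoint_works [OF lin, of "adjoint F x" x] by (simp add: inner_commute)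
      finally have "F x = 0 \<longleftrightarrow> adjoint F x = 0"
        by (metis inner_eq_zero_iff)
      also have "\<dots> \<longleftrightarrow> (\<forall>y. inner y (adjoint F x) = 0)"
        by (metis inner_eq_zero_iff inner_zero_right)
      also have "\<dots> \<longleftrightarrow> (\<forall>v\<in>V'. inner x v = 0)"
        by (auto simp: adjoint_works [OF lin] inner_commute simp flip: F(2))
      finally show "x \<in> orthogonal_comp V \<longleftrightarrow> x \<in> orthogonal_comp V'"
        by (simp add: F(3) orthogonal_comp_def orthogonal_def inner_commute)
    qed
    then show ?thesis
      using V V' by (metis orthogonal_comp_self real_submodule_def)
  qed
  then show ?thesis
    by blast
qed

end
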